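(* Let $n \ge 2$ and $k \ge 1$ be integers. Let $p(X_1,\ldots,X_k)$ be a generalized permanent, i.e. a polynomial (of any degree) over $\mathbb{C}$ in the entries of $k$ variable $n\times n$ matrices $X_1,\ldots,X_k$ such that for all nonsingular complex $n\times n$ matrices $U_1,V_1,\ldots,U_k,V_k$, \[ p(U_1X_1V_1,\ldots,U_kX_kV_k)=p(X_1,\ldots,X_k) \iff \mathrm{perm}(U_iXV_i)=\mathrm{perm}(X) \text{ for all } i \le k \text{ (as polynomial identities in a variable } n\times n \text{ matrix } X). \] Then for any complex $n\times n$ matrices $B_1,C_1,\ldots,B_k,C_k$ (possibly singular), setting $\bar X_i=B_iX_iC_i$, the polynomial $p(X_1,\ldots,X_k)$ cannot be expressed as a polynomial function of the traces $\mathrm{trace}(\bar X_i^{\,j})$, $1\le i\le k$, $j\ge 0$.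
   Context: $\mathrm{perm}(X)$ denotes the permanent of the $n\times n$ matrix $X$, i.e. $\sum_{\sigma\in S_n}\prod_{r=1}^n x_{r,\sigma(r)}$. The expression "polynomial function of the traces" means $p = F(\mathrm{trace}(\bar X_1^{0}),\mathrm{trace}(\bar X_1^{1}),\ldots)$ for some polynomial $F$ in finitely many of these traces, with identity of polynomials in the entries of $X_1,\ldots,X_k$. The paper also asserts the same statement over any algebraically closed field of characteristic different from two. *)

theory Defs
  imports "HOL-Analysis.Analysis" "HOL-Library.Poly_Mapping"
begin

text \<open>
  Polynomials are formal: finitely supported maps from monomials (exponent vectors) to
  coefficients, with the convolution product of \<^theory>\<open>HOL-Library.Poly_Mapping\<close>.
  All identities below are therefore equations in a polynomial ring.
\<close>

type_synonym 'v cpoly = "('v \<Rightarrow>\<^sub>0 nat) \<Rightarrow>\<^sub>0 complex"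

definition cpoly_const :: "complex \<Rightarrow> 'v cpoly" where
  "cpoly_const c = Poly_Mapping.single 0 c"

definition cpoly_var :: "'v \<Rightarrow> 'v cpoly" where
  "cpoly_var v = Poly_Mapping.single (Poly_Mapping.single v 1) 1"

definition cpoly_subst :: "('v \<Rightarrow> 'w cpoly) \<Rightarrow> 'v cpoly \<Rightarrow> 'w cpoly" where
  "cpoly_subst \<sigma> p =
     (\<Sum>m\<in>Poly_Mapping.keys p. cpoly_const (Poly_Mapping.lookup p m) *
        (\<Prod>v\<in>Poly_Mapping.keys m. \<sigma> v ^ Poly_Mapping.lookup m v))"

abbreviation const_matrix :: "complex^'n^'n \<Rightarrow> 'v cpoly^'n^'n" where
  "const_matrix A \<equiv> map_matrix cpoly_const A"

definition generic_matrix :: "('n \<times> 'n) cpoly^'n^'n" where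
  "generic_matrix = (\<chi> r s. cpoly_var (r, s))"

text \<open>The variable \<^term>\<open>(i, r, s)\<close> is the \<^term>\<open>(r, s)\<close> entry of the \<^term>\<open>i\<close>-th variable matrix.\<close>

definition generic_matrices :: "'k \<Rightarrow> ('k \<times> 'n \<times> 'n) cpoly^'n^'n" where
  "generic_matrices i = (\<chi> r s. cpoly_var (i, r, s))"

text \<open>Substitution of a tuple of matrices \<^term>\<open>Y\<close> (with polynomial entries) for the variable matrices.\<close>

definition subst_matrices ::
  "('k \<times> 'n \<times> 'n) cpoly \<Rightarrow> ('k \<Rightarrow> 'w cpoly^'n^'n) \<Rightarrow> 'w cpoly" where
  "subst_matrices p Y = cpoly_subst (\<lambda>(i, r, s). Y i $ r $ s) p"

definition permanent :: "'a::comm_semiring_1^'n^'n \<Rightarrow> 'a" where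
  "permanent X = (\<Sum>\<sigma> | \<sigma> permutes (UNIV :: 'n set). \<Prod>r\<in>UNIV. X $ r $ \<sigma> r)"

definition generalized_permanent :: "('k::finite \<times> 'n::finite \<times> 'n) cpoly \<Rightarrow> bool" where
  "generalized_permanent p \<longleftrightarrow>
     (\<forall>U V :: 'k \<Rightarrow> complex^'n^'n.
        (\<forall>i. invertible (U i) \<and> invertible (V i)) \<longrightarrow>
        (subst_matrices p (\<lambda>i. const_matrix (U i) ** generic_matrices i ** const_matrix (V i))
           = p
         \<longleftrightarrow>
         (\<forall>i. permanent (const_matrix (U i) ** generic_matrix ** const_matrix (V i))
                = permanent (generic_matrix :: ('n \<times> 'n) cpoly^'n^'n))))"

primrec matrix_power :: "'a::semiring_1^'n^'n \<Rightarrow> nat \<Rightarrow> 'a^'n^'n" where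
  "matrix_power A 0 = mat 1"
| "matrix_power A (Suc j) = A ** matrix_power A j"

text \<open>
  \<^term>\<open>F\<close> has one variable for each pair \<^term>\<open>(i, j)\<close>, standing for the trace of the \<^term>\<open>j\<close>-th
  power of \<^term>\<open>Y i\<close>; being a polynomial it involves only finitely many of them.
\<close>

definition polynomial_in_traces ::
  "'w cpoly \<Rightarrow> ('k \<Rightarrow> 'w cpoly^'n^'n) \<Rightarrow> bool" where
  "polynomial_in_traces q Y \<longleftrightarrow>
     (\<exists>F :: ('k \<times> nat) cpoly. q = cpoly_subst (\<lambda>(i, j). trace (matrix_power (Y i) j)) F)"

end

theory Submission
  imports Defs
begin

text \<open>
  The trace of a power of \<open>B X C\<close> depends only on \<open>D X\<close> up to conjugation, where \<open>D = C B\<close>. Hence a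
  polynomial in these traces is invariant under \<open>X \<mapsto> U X V\<close> whenever \<open>V D U = D\<close>. If \<open>D \<noteq> 0\<close>, such
  \<open>U\<close> and \<open>V\<close> can be chosen so that \<open>U\<close> maps a vector \<open>x\<close> without zero entries to a unit vector;
  the rank-one matrix \<open>x (1, \<dots>, 1)\<close> then has nonzero permanent, while its image has zero rows.
  If \<open>D = 0\<close>, take \<open>U = 2 I\<close> and \<open>V = I\<close>. Either way the permanent is not preserved.
\<close>

section \<open>Semiring homomorphisms applied entrywise to matrices\<close>

locale comm_semiring_1_hom =
  fixes h :: "'a::comm_semiring_1 \<Rightarrow> 'b::comm_semiring_1"
  assumes hom_zero: "h 0 = 0"
    and hom_one: "h 1 = 1"
    and hom_add: "h (x + y) = h x + h y"
    and hom_mult: "h (x * y) = h x * h y"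
begin

lemma hom_sum: "h (sum f A) = (\<Sum>x\<in>A. h (f x))"
  by (induction A rule: infinite_finite_induct) (auto simp: hom_zero hom_add)

lemma hom_prod: "h (prod f A) = (\<Prod>x\<in>A. h (f x))"
  by (induction A rule: infinite_finite_induct) (auto simp: hom_one hom_mult)

lemma hom_power: "h (x ^ m) = h x ^ m"
  by (induction m) (auto simp: hom_one hom_mult)

lemma map_matrix_mult: "map_matrix h (A ** M) = map_matrix h A ** map_matrix h M"
  by (simp add: matrix_matrix_mult_def map_matrix_def vec_eq_iff hom_sum hom_mult)

lemma map_matrix_mat_1: "map_matrix h (mat 1) = mat 1"
  by (simp add: mat_def map_matrix_def vec_eq_iff hom_zero hom_one)

lemma hom_trace: "h (trace A) = trace (map_matrix h A)"
  by (simp add: trace_def map_matrix_def hom_sum)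

lemma map_matrix_power: "map_matrix h (matrix_power A j) = matrix_power (map_matrix h A) j"
  by (induction j) (simp_all add: map_matrix_mult map_matrix_mat_1)

lemma hom_permanent: "h (permanent A) = permanent (map_matrix h A)"
  by (simp add: permanent_def map_matrix_def hom_sum hom_prod)

end

section \<open>Substitution as a homomorphism of polynomial rings\<close>

interpretation cpoly_const: comm_semiring_1_hom cpoly_const
  by unfold_locales (simp_all add: cpoly_const_def single_add mult_single)

lemma inj_cpoly_const: "inj cpoly_const"
  unfolding cpoly_const_def[abs_def] by (rule inj_single)

definition monomial_subst :: "('v \<Rightarrow> 'w cpoly) \<Rightarrow> ('v \<Rightarrow>\<^sub>0 nat) \<Rightarrow> 'w cpoly" where
  "monomial_subst \<sigma> m = (\<Prod>v\<in>Poly_Mapping.keys m. \<sigma> v ^ Poly_Mapping.lookup m v)"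

text \<open>A variable outside the support has exponent 0 and contributes the factor 1. Products for
  different monomials can thus share one index set.\<close>

lemma monomial_subst_superset:
  assumes "finite A" "Poly_Mapping.keys m \<subseteq> A"
  shows "monomial_subst \<sigma> m = (\<Prod>v\<in>A. \<sigma> v ^ Poly_Mapping.lookup m v)"
  unfolding monomial_subst_def
  by (rule prod.mono_neutral_left) (use assms in \<open>auto simp: in_keys_iff\<close>)

lemma monomial_subst_add:
  "monomial_subst \<sigma> (m + m') = monomial_subst \<sigma> m * monomial_subst \<sigma> m'"
proof -
  let ?A = "Poly_Mapping.keys m \<union> Poly_Mapping.keys m'"
  have "Poly_Mapping.keys (m + m') \<subseteq> ?A"
    by (rule Poly_Mapping.keys_add)
  then show ?thesis
    by (simp add: monomial_subst_superset[of ?A] lookup_add power_add prod.distrib)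
qed

text \<open>Coefficients may cancel in \<open>p + q\<close>, so its support can be smaller than the
  union of the two supports; padding with zero terms gives a common index set.\<close>

lemma cpoly_subst_superset:
  assumes "finite A" "Poly_Mapping.keys p \<subseteq> A"
  shows "cpoly_subst \<sigma> p = (\<Sum>m\<in>A. cpoly_const (Poly_Mapping.lookup p m) * monomial_subst \<sigma> m)"
  unfolding cpoly_subst_def monomial_subst_def
  by (rule sum.mono_neutral_left)
    (use assms in \<open>auto simp: in_keys_iff cpoly_const.hom_zero\<close>)

lemma cpoly_subst_add: "cpoly_subst \<sigma> (p + q) = cpoly_subst \<sigma> p + cpoly_subst \<sigma> q"
proof -
  let ?A = "Poly_Mapping.keys p \<union> Poly_Mapping.keys q"
  have "Poly_Mapping.keys (p + q) \<subseteq> ?A"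
    by (rule Poly_Mapping.keys_add)
  then show ?thesis
    by (simp add: cpoly_subst_superset[of ?A] lookup_add cpoly_const.hom_add
        distrib_right sum.distrib)
qed

lemma cpoly_subst_zero: "cpoly_subst \<sigma> 0 = 0"
  by (simp add: cpoly_subst_def)

lemma cpoly_subst_sum: "cpoly_subst \<sigma> (sum f A) = (\<Sum>x\<in>A. cpoly_subst \<sigma> (f x))"
  by (induction A rule: infinite_finite_induct) (auto simp: cpoly_subst_zero cpoly_subst_add)

lemma cpoly_subst_single:
  "cpoly_subst \<sigma> (Poly_Mapping.single m c) = cpoly_const c * monomial_subst \<sigma> m"
  by (subst cpoly_subst_superset[of "{m}"]) auto

lemma sum_single_lookup:
  "(\<Sum>m\<in>Poly_Mapping.keys p. Poly_Mapping.single m (Poly_Mapping.lookup p m)) = p"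
  by (rule poly_mapping_eqI)
    (auto simp: lookup_sum lookup_single when_def in_keys_iff)

lemma cpoly_subst_mult: "cpoly_subst \<sigma> (p * q) = cpoly_subst \<sigma> p * cpoly_subst \<sigma> q"
proof -
  \<comment> \<open>Splitting both factors into single terms reduces the claim to products of two
    terms, where exponents add and \<open>monomial_subst_add\<close> applies.\<close>
  have "p * q = (\<Sum>m\<in>Poly_Mapping.keys p. \<Sum>m'\<in>Poly_Mapping.keys q.
      Poly_Mapping.single m (Poly_Mapping.lookup p m) *
      Poly_Mapping.single m' (Poly_Mapping.lookup q m'))"
    by (simp only: sum_product[symmetric] sum_single_lookup)
  then have "cpoly_subst \<sigma> (p * q) =
      (\<Sum>m\<in>Poly_Mapping.keys p. \<Sum>m'\<in>Poly_Mapping.keys q.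
        (cpoly_const (Poly_Mapping.lookup p m) * monomial_subst \<sigma> m) *
        (cpoly_const (Poly_Mapping.lookup q m') * monomial_subst \<sigma> m'))"
    by (simp add: cpoly_subst_sum mult_single cpoly_subst_single monomial_subst_add
        cpoly_const.hom_mult mult_ac)
  also have "\<dots> = cpoly_subst \<sigma> p * cpoly_subst \<sigma> q"
    by (simp add: cpoly_subst_def monomial_subst_def sum_product)
  finally show ?thesis .
qed

lemma cpoly_subst_const: "cpoly_subst \<sigma> (cpoly_const c) = cpoly_const c"
  using cpoly_subst_single[of \<sigma> 0 c]
  by (simp add: cpoly_const_def monomial_subst_def)

text \<open>From here on, substitution commutes with matrix products, matrix powers, traces and
  permanents.\<close>

interpretation cpoly_subst: comm_semiring_1_hom "cpoly_subst \<sigma>" for \<sigma>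
proof
  show "cpoly_subst \<sigma> 1 = 1"
    using cpoly_subst_const[of \<sigma> 1] by (simp add: cpoly_const.hom_one)
qed (simp_all add: cpoly_subst_zero cpoly_subst_add cpoly_subst_mult)

lemma cpoly_subst_var: "cpoly_subst \<sigma> (cpoly_var v) = \<sigma> v"
  by (simp add: cpoly_var_def cpoly_subst_single monomial_subst_def cpoly_const.hom_one)

lemma cpoly_subst_cpoly_subst:
  "cpoly_subst \<sigma> (cpoly_subst \<tau> p) = cpoly_subst (\<lambda>v. cpoly_subst \<sigma> (\<tau> v)) p"
  \<comment> \<open>Only the inner substitution is expanded; the outer one then acts on the
    resulting expression as a homomorphism.\<close>
  unfolding cpoly_subst_def[of \<tau>]
  by (simp add: cpoly_subst.hom_sum cpoly_subst.hom_mult cpoly_subst.hom_prod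
      cpoly_subst.hom_power cpoly_subst_const)
    (simp add: cpoly_subst_def)

lemma map_matrix_cpoly_subst_const: "map_matrix (cpoly_subst \<sigma>) (const_matrix A) = const_matrix A"
  by (simp add: map_matrix_def vec_eq_iff cpoly_subst_const)

lemma map_matrix_cpoly_subst_generic_matrix:
  "map_matrix (cpoly_subst (\<lambda>(r, s). Y $ r $ s)) generic_matrix = Y"
  by (simp add: map_matrix_def vec_eq_iff generic_matrix_def cpoly_subst_var)

lemma map_matrix_cpoly_subst_generic_matrices:
  "map_matrix (cpoly_subst (\<lambda>(i, r, s). Y i $ r $ s)) (generic_matrices i) = Y i"
  by (simp add: map_matrix_def vec_eq_iff generic_matrices_def cpoly_subst_var)

section \<open>Invariance of the traces\<close>

lemma matrix_power_mult_Suc: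
  "matrix_power (A ** M) (Suc j) = A ** matrix_power (M ** A) j ** M"
  by (induction j) (simp_all add: matrix_mul_assoc)

text \<open>A positive power of \<open>A ** M\<close> is
  \<open>A ** matrix_power (M ** A) i ** M\<close>, and cyclicity of the trace carries the last
  \<open>M\<close> to the front. For exponent 0 both powers are the identity.\<close>

lemma trace_matrix_power_mult_commute:
  fixes A M :: "'a::comm_semiring_1^'n^'n"
  shows "trace (matrix_power (A ** M) j) = trace (matrix_power (M ** A) j)"
proof (cases j)
  case (Suc i)
  have "trace (A ** matrix_power (M ** A) i ** M) = trace (M ** (A ** matrix_power (M ** A) i))"
    by (rule trace_mul_sym)
  then show ?thesis
    by (simp only: Suc matrix_power_mult_Suc[of A M]) (simp add: matrix_mul_assoc)
qed simp

text \<open>Under the trace of a power, BUXVC may be rotated to XVCBU. The assumption shortens this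
  to XCB, which rotates back to BXC.\<close>

lemma subst_matrices_polynomial_in_traces:
  fixes B C U V :: "'k \<Rightarrow> complex^'n^'n"
  assumes p: "polynomial_in_traces p
      (\<lambda>i. const_matrix (B i) ** generic_matrices i ** const_matrix (C i))"
    and UV: "\<And>i. V i ** (C i ** B i) ** U i = C i ** B i"
  shows "subst_matrices p (\<lambda>i. const_matrix (U i) ** generic_matrices i ** const_matrix (V i)) = p"
proof -
  let ?Y = "\<lambda>i. const_matrix (B i) ** generic_matrices i ** const_matrix (C i)"
  let ?Z = "\<lambda>i. const_matrix (U i) ** generic_matrices i ** const_matrix (V i)"
  let ?h = "cpoly_subst (\<lambda>(i, r, s). ?Z i $ r $ s)"
  obtain F :: "('k \<times> nat) cpoly"
    where F: "p = cpoly_subst (\<lambda>(i, j). trace (matrix_power (?Y i) j)) F"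
    using p unfolding polynomial_in_traces_def by blast
  \<comment> \<open>\<open>?h\<close> replaces each variable matrix X by UXV. Since \<open>p\<close>
    is a polynomial in the traces, it suffices that \<open>?h\<close> fixes each of them.\<close>
  have "?h (trace (matrix_power (?Y i) j)) = trace (matrix_power (?Y i) j)" for i j
  proof -
    let ?G = "generic_matrices i :: ('k \<times> 'n \<times> 'n) cpoly^'n^'n"
    let ?B = "const_matrix (B i) :: ('k \<times> 'n \<times> 'n) cpoly^'n^'n"
    let ?C = "const_matrix (C i) :: ('k \<times> 'n \<times> 'n) cpoly^'n^'n"
    let ?U = "const_matrix (U i) :: ('k \<times> 'n \<times> 'n) cpoly^'n^'n"
    let ?V = "const_matrix (V i) :: ('k \<times> 'n \<times> 'n) cpoly^'n^'n"
    have UV': "?V ** (?C ** (?B ** ?U)) = ?C ** ?B"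
      by (simp only: cpoly_const.map_matrix_mult[symmetric] UV[unfolded matrix_mul_assoc[symmetric]])
    have "map_matrix ?h (?Y i) = (?B ** ?U) ** (?G ** ?V ** ?C)"
      by (simp add: cpoly_subst.map_matrix_mult map_matrix_cpoly_subst_const
          map_matrix_cpoly_subst_generic_matrices matrix_mul_assoc)
    then have "?h (trace (matrix_power (?Y i) j))
        = trace (matrix_power ((?G ** ?V ** ?C) ** (?B ** ?U)) j)"
      by (simp only: cpoly_subst.hom_trace cpoly_subst.map_matrix_power
          trace_matrix_power_mult_commute[of "?B ** ?U"])
    also have "(?G ** ?V ** ?C) ** (?B ** ?U) = (?G ** ?C) ** ?B"
      by (simp only: UV' matrix_mul_assoc[symmetric])
    also have "trace (matrix_power ((?G ** ?C) ** ?B) j) = trace (matrix_power (?Y i) j)"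
      by (simp only: trace_matrix_power_mult_commute[of _ ?B] matrix_mul_assoc)
    finally show ?thesis .
  qed
  then have "(\<lambda>x. ?h (case x of (i, j) \<Rightarrow> trace (matrix_power (?Y i) j)))
      = (\<lambda>(i, j). trace (matrix_power (?Y i) j))"
    by (simp add: fun_eq_iff)
  then show ?thesis
    by (simp only: subst_matrices_def F cpoly_subst_cpoly_subst)
qed

text \<open>The polynomial identity is specialised at the entries of \<open>X\<close>, viewed as
  constant polynomials; injectivity of \<open>cpoly_const\<close> then brings it back to complex
  numbers.\<close>

lemma permanent_evaluate_generic:
  fixes U V X :: "complex^'n^'n"
  assumes "permanent (const_matrix U ** generic_matrix ** const_matrix V)
      = permanent (generic_matrix :: ('n \<times> 'n) cpoly^'n^'n)"
  shows "permanent (U ** X ** V) = permanent X"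
proof -
  let ?X = "const_matrix X :: ('n \<times> 'n) cpoly^'n^'n"
  let ?h = "cpoly_subst (\<lambda>(r, s). ?X $ r $ s)"
  have "?h (permanent (const_matrix U ** generic_matrix ** const_matrix V))
      = ?h (permanent generic_matrix)"
    using assms by simp
  then have "permanent (const_matrix (U ** X ** V)) = permanent ?X"
    by (simp only: cpoly_subst.hom_permanent cpoly_subst.map_matrix_mult
        map_matrix_cpoly_subst_const map_matrix_cpoly_subst_generic_matrix
        cpoly_const.map_matrix_mult)
  then show ?thesis
    by (simp only: cpoly_const.hom_permanent[symmetric] inj_eq[OF inj_cpoly_const])
qed

section \<open>Outer products and rank-one perturbations of the identity\<close>

definition outer_product :: "'a::times^'m \<Rightarrow> 'a^'n \<Rightarrow> 'a^'n^'m" where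
  "outer_product a b = (\<chi> r s. a $ r * b $ s)"

lemma matrix_mult_outer_product:
  fixes A :: "'a::comm_semiring_1^'m^'l"
  shows "A ** outer_product a b = outer_product (A *v a) b"
  by (simp add: matrix_matrix_mult_def matrix_vector_mult_def outer_product_def vec_eq_iff
      sum_distrib_left mult_ac)

lemma outer_product_matrix_mult:
  fixes A :: "'a::comm_semiring_1^'l^'n"
  shows "outer_product a b ** A = outer_product a (b v* A)"
  by (simp add: matrix_matrix_mult_def vector_matrix_mult_def outer_product_def vec_eq_iff
      sum_distrib_left mult_ac)

lemma outer_product_matrix_vector_mult:
  fixes b :: "'a::comm_semiring_1^'n"
  shows "outer_product a b *v c = (\<Sum>i\<in>UNIV. b $ i * c $ i) *s a"
  by (simp add: matrix_vector_mult_def outer_product_def vec_eq_iff sum_distrib_left mult_ac)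

lemma matrix_mult_add_left:
  fixes A B :: "'a::semiring_1^'n^'m"
  shows "(A + B) ** C = A ** C + B ** C"
  by (simp add: matrix_matrix_mult_def vec_eq_iff distrib_right sum.distrib)

text \<open>All n! permutations contribute the same product, because permuting the entries of
  \<open>b\<close> does not change their product.\<close>

lemma permanent_outer_product:
  fixes a b :: "'a::comm_semiring_1^'n"
  shows "permanent (outer_product a b)
    = of_nat (fact CARD('n)) * ((\<Prod>r\<in>UNIV. a $ r) * (\<Prod>r\<in>UNIV. b $ r))"
proof -
  have "(\<Prod>r\<in>UNIV. outer_product a b $ r $ \<sigma> r) = (\<Prod>r\<in>UNIV. a $ r) * (\<Prod>r\<in>UNIV. b $ r)"
    if "\<sigma> permutes UNIV" for \<sigma>
    using prod.permute[OF that, of "\<lambda>r. b $ r"]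
    by (simp add: outer_product_def prod.distrib o_def)
  then have "permanent (outer_product a b)
      = (\<Sum>\<sigma> | \<sigma> permutes (UNIV :: 'n set). (\<Prod>r\<in>UNIV. a $ r) * (\<Prod>r\<in>UNIV. b $ r))"
    unfolding permanent_def by (intro sum.cong) auto
  then show ?thesis
    by (simp add: card_permutations[OF refl])
qed

text \<open>This is the Sherman-Morrison formula: the inverse is again the identity plus an outer
  product with first factor \<open>a\<close>.\<close>

lemma invertible_mat_1_plus_outer_product:
  fixes a b :: "'a::field^'n"
  assumes "1 + (\<Sum>i\<in>UNIV. b $ i * a $ i) \<noteq> 0"
  shows "invertible (mat 1 + outer_product a b)"
proof -
  define t where "t = (\<Sum>i\<in>UNIV. b $ i * a $ i)"
  \<comment> \<open>Multiplying out leaves the outer product of \<open>a\<close> with b + c + tc as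
    error term; this \<open>c\<close> makes it vanish.\<close>
  define c where "c = (- 1 / (1 + t)) *s b"
  have "1 + t \<noteq> 0"
    using assms by (simp add: t_def)
  then have "(1 + t) * c $ s = - b $ s" for s
    by (simp add: c_def)
  then have c: "b $ s + c $ s + t * c $ s = 0" for s
    by (simp add: distrib_right add.assoc)
  have "outer_product a b ** outer_product a c = outer_product (t *s a) c"
    by (simp only: matrix_mult_outer_product outer_product_matrix_vector_mult t_def)
  then have "(mat 1 + outer_product a b) ** (mat 1 + outer_product a c)
      = mat 1 + outer_product a b + outer_product a c + outer_product (t *s a) c"
    by (simp add: matrix_add_ldistrib matrix_mult_add_left)
  also have "\<dots> = mat 1"
  proof -
    have "a $ r * b $ s + (a $ r * c $ s + t * a $ r * c $ s) = a $ r * (b $ s + c $ s + t * c $ s)"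
      for r s
      by (simp add: algebra_simps)
    then have "a $ r * b $ s + (a $ r * c $ s + t * a $ r * c $ s) = 0" for r s
      by (simp only: c mult_zero_right)
    then show ?thesis
      by (simp add: outer_product_def vec_eq_iff add.assoc)
  qed
  finally show ?thesis
    by (rule invertible_right_inverse[THEN iffD2, OF exI])
qed

text \<open>Let U = I + a \<phi>^T, where a = e_l - x and \<phi>^T x = 1, so that Ux = e_l. Taking
  \<phi>^T = \<psi>^T D in the row space of D gives DU = WD with W = I + (Da) \<psi>^T, and V is the
  inverse of W.\<close>

lemma exists_nonzero_vector_to_axis:
  fixes D :: "complex^'n^'n"
  assumes "D \<noteq> 0"
  obtains U V x l where "invertible U" "invertible V" "V ** D ** U = D"
    "\<And>r. x $ r \<noteq> 0" "U *v x = axis l 1"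
proof -
  obtain m l where d: "D $ m $ l \<noteq> 0"
    using assms by (auto simp: vec_eq_iff)
  \<comment> \<open>\<open>1\<close> is the all-ones vector. If D sends it to a vector with m-th
    entry 0, adding e_l changes that entry by the nonzero \<open>D $ m $ l\<close>. The entries of
    \<open>x\<close> are 1 or 2.\<close>
  define x :: "complex^'n" where
    "x = (if (D *v 1) $ m = 0 then 1 + axis l 1 else 1)"
  define \<beta> where "\<beta> = (D *v x) $ m"
  have De: "D *v axis l 1 = column l D"
    by (simp add: matrix_vector_mult_def column_def axis_def vec_eq_iff if_distrib[of "\<lambda>t. _ * t"]
        cong: if_cong)
  have \<beta>: "\<beta> \<noteq> 0"
    using d by (auto simp: \<beta>_def x_def matrix_vector_right_distrib De column_def)
  have x: "x $ r \<noteq> 0" for r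
    by (auto simp: x_def axis_def)
  define a where "a = axis l 1 - x"
  \<comment> \<open>The scaling by 1 / \<beta> is what makes \<phi>^T x equal to 1.\<close>
  define \<psi> :: "complex^'n" where "\<psi> = axis m (1 / \<beta>)"
  define \<phi> where "\<phi> = \<psi> v* D"
  have \<psi>_sum: "(\<Sum>i\<in>UNIV. \<psi> $ i * v $ i) = v $ m / \<beta>" for v
    by (simp add: \<psi>_def axis_def if_distrib[of "\<lambda>t. t * _"] cong: if_cong)
  have \<phi>_sum: "(\<Sum>i\<in>UNIV. \<phi> $ i * v $ i) = (D *v v) $ m / \<beta>" for v
  proof -
    have "\<phi> $ i = D $ m $ i / \<beta>" for i
      using \<psi>_sum[of "column i D"]
      by (simp add: \<phi>_def vector_matrix_mult_def column_def mult.commute)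
    then show ?thesis
      by (simp add: matrix_vector_mult_def sum_divide_distrib)
  qed
  \<comment> \<open>As (Da)_m is \<open>D $ m $ l\<close> minus \<beta>, the value is
    \<open>D $ m $ l\<close> divided by \<beta>. It is the invertibility condition for both
    \<open>U\<close> and \<open>W\<close>.\<close>
  have nz: "1 + (D *v a) $ m / \<beta> \<noteq> 0"
    using d \<beta> by (simp add: a_def matrix_vector_mult_diff_distrib De column_def
        \<beta>_def[symmetric] field_simps)
  define U where "U = mat 1 + outer_product a \<phi>"
  define W where "W = mat 1 + outer_product (D *v a) \<psi>"
  have U: "invertible U"
    unfolding U_def by (rule invertible_mat_1_plus_outer_product) (use nz in \<open>simp add: \<phi>_sum\<close>)
  have W: "invertible W"
    unfolding W_def by (rule invertible_mat_1_plus_outer_product) (use nz in \<open>simp add: \<psi>_sum\<close>)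
  have "D ** U = W ** D"
    by (simp add: U_def W_def \<phi>_def matrix_add_ldistrib matrix_mult_add_left
        matrix_mult_outer_product outer_product_matrix_mult)
  moreover obtain V where V: "W ** V = mat 1" "V ** W = mat 1"
    using W unfolding invertible_def by blast
  ultimately have "V ** D ** U = D"
    by (metis matrix_mul_assoc matrix_mul_lid)
  moreover have "U *v x = axis l 1"
    using \<beta> by (simp add: U_def matrix_vector_mult_add_rdistrib outer_product_matrix_vector_mult
        \<phi>_sum \<beta>_def[symmetric] a_def)
  moreover have "invertible V"
    using V unfolding invertible_def by blast
  ultimately show thesis
    using that U x by blast
qed

section \<open>Pairs that stabilise D but change a permanent\<close>

lemma exists_stabilizer_changing_permanent:
  fixes D :: "complex^'n^'n"
  assumes n: "CARD('n) \<ge> 2"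
  obtains U V X :: "complex^'n^'n" where "invertible U" "invertible V" "V ** D ** U = D"
    "permanent (U ** X ** V) \<noteq> permanent X"
proof (cases "D = 0")
  case True
  \<comment> \<open>\<open>?X\<close> is the all-ones matrix, with permanent n!; the scalar matrix
    \<open>?U\<close> multiplies this by 2^n.\<close>
  let ?U = "mat 2 :: complex^'n^'n" and ?X = "outer_product 1 1 :: complex^'n^'n"
  have U1: "?U *v 1 = (\<chi> i. 2)"
    by (simp add: matrix_vector_mult_def mat_def vec_eq_iff if_distrib[of "\<lambda>t. t * _"] cong: if_cong)
  have "?U ** mat (1/2) = mat 1"
    by (simp add: matrix_matrix_mult_def mat_def vec_eq_iff if_distrib[of "\<lambda>t. t * _"] cong: if_cong)
  then have "invertible ?U"
    by (rule invertible_right_inverse[THEN iffD2, OF exI])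
  moreover have "permanent (?U ** ?X ** mat 1) \<noteq> permanent ?X"
  proof -
    have "(2::complex) ^ CARD('n) \<noteq> 1"
    proof
      assume "(2::complex) ^ CARD('n) = 1"
      \<comment> \<open>Norms move the equation to the reals, where the order shows 2^n > 1.\<close>
      then have "norm ((2::complex) ^ CARD('n)) = 1"
        by simp
      then have "(2::real) ^ CARD('n) = 1"
        by (simp add: norm_power)
      then show False
        using n one_less_power[of "2::real" "CARD('n)"] by simp
    qed
    then show ?thesis
      by (simp add: matrix_mult_outer_product permanent_outer_product U1)
  qed
  moreover have "mat 1 ** D ** ?U = D"
    by (simp add: True)
  ultimately show thesis
    using that[of ?U "mat 1" ?X] by (simp add: invertible_def exI[of _ "mat 1"])
next
  case False
  then obtain U V :: "complex^'n^'n" and x l where UV: "invertible U" "invertible V" "V ** D ** U = D"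
    and x: "\<And>r. x $ r \<noteq> 0" and Ux: "U *v x = axis l 1"
    by (rule exists_nonzero_vector_to_axis) blast
  \<comment> \<open>A second index gives e_l a zero entry, which kills the permanent of any outer
    product with first factor e_l.\<close>
  have "\<exists>r. r \<noteq> l"
  proof (rule ccontr)
    assume "\<nexists>r. r \<noteq> l"
    then have "(UNIV :: 'n set) = {l}"
      by auto
    then have "CARD('n) = card {l}"
      by (rule arg_cong)
    then show False
      using n by simp
  qed
  then obtain r where "r \<noteq> l"
    by blast
  then have "(\<Prod>r\<in>UNIV. (axis l 1 :: complex^'n) $ r) = 0"
    by (intro prod_zero) (auto simp: axis_def)
  then have "permanent (U ** outer_product x 1 ** V) = 0"
    by (simp add: matrix_mult_outer_product outer_product_matrix_mult Ux permanent_outer_product)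
  moreover have "permanent (outer_product x (1 :: complex^'n)) \<noteq> 0"
    using x by (simp add: permanent_outer_product)
  ultimately show thesis
    using that[OF UV, of "outer_product x 1"] by simp
qed

theorem theorem8p3:
  fixes p :: "('k::finite \<times> 'n::finite \<times> 'n) cpoly"
    and B C :: "'k \<Rightarrow> complex^'n^'n"
  assumes "CARD('n) \<ge> 2"
    and "generalized_permanent p"
  shows "\<not> polynomial_in_traces p
            (\<lambda>i. const_matrix (B i) ** generic_matrices i ** const_matrix (C i))"
proof
  assume traces: "polynomial_in_traces p
      (\<lambda>i. const_matrix (B i) ** generic_matrices i ** const_matrix (C i))"
  \<comment> \<open>The pair depends on \<open>i\<close> through D = \<open>C i ** B i\<close>, so
    one is chosen for every index.\<close>
  have "\<forall>i. \<exists>U V X :: complex^'n^'n. invertible U \<and> invertible V \<and>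
      V ** (C i ** B i) ** U = C i ** B i \<and> permanent (U ** X ** V) \<noteq> permanent X"
    using exists_stabilizer_changing_permanent[OF assms(1)] by metis
  then obtain U V X :: "'k \<Rightarrow> complex^'n^'n"
    where inv: "\<And>i. invertible (U i)" "\<And>i. invertible (V i)"
      and stab: "\<And>i. V i ** (C i ** B i) ** U i = C i ** B i"
      and perm: "\<And>i. permanent (U i ** X i ** V i) \<noteq> permanent (X i)"
    by metis
  have "subst_matrices p (\<lambda>i. const_matrix (U i) ** generic_matrices i ** const_matrix (V i)) = p"
    using traces stab by (rule subst_matrices_polynomial_in_traces)
  \<comment> \<open>The forward direction of the equivalence in \<open>generalized_permanent\<close>
    turns invariance of \<open>p\<close> into invariance of the permanent, which \<open>X i\<close>
    refutes at any index \<open>i\<close>.\<close>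
  then have "permanent (const_matrix (U i) ** generic_matrix ** const_matrix (V i))
      = permanent (generic_matrix :: ('n \<times> 'n) cpoly^'n^'n)" for i
    using assms(2) inv unfolding generalized_permanent_def by blast
  then show False
    using permanent_evaluate_generic perm by blast
qed

end
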